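(* Let $(X,\mathcal{A},\lambda)$ be a $\sigma$-finite measure space, $T:X\to X$ a null-preserving map, and $A\in\mathcal{A}$. Then $A$ is forward invariant if and only if $\hat{T}A\overset{.}{\subseteq}A$. In particular, $A$ is invariant if and only if $\hat{T}A\overset{.}{\subseteq}A$ and $\hat{T}A^c\overset{.}{\subseteq}A^c$. Therefore the system $(X,\mathcal{A},\lambda,T)$ is ergodic if and only if, for every $A\in\mathcal{A}$, the conditions $\hat{T}A\overset{.}{\subseteq}A$ and $\hat{T}A^c\overset{.}{\subseteq}A^c$ together imply $\lambda(A)\lambda(A^c)=0$.
   Context: For $A,B\in\mathcal{A}$ write $A\overset{.}{\subseteq}B$ if $\lambda(A\setminus B)=0$ and $A\overset{.}{=}B$ if $\lambda(A\triangle B)=0$. A measurable map $T:X\to X$ is null-preserving if $\lambda(A)=0$ implies $\lambda(T^{-1}A)=0$ for $A\in\mathcal{A}$. An essential image of $A\in\mathcal{A}$ under $T$ is a set $A'\in\mathcal{A}$ such that $T^{-1}A'\overset{.}{\supseteq}A$ and such that every $B'\in\mathcal{A}$ with $T^{-1}B'\overset{.}{\supseteq}A$ satisfies $B'\overset{.}{\supseteq}A'$. In the present ($\sigma$-finite, null-preserving) setting every $A\in\mathcal{A}$ has essential images and they form exactly one equivalence class under $\overset{.}{=}$; $\hat{T}A$ denotes an arbitrary fixed essential image of $A$. A set $A\in\mathcal{A}$ is forward invariant if $A\overset{.}{\subseteq}T^{-1}A$ and invariant if $A\overset{.}{=}T^{-1}A$. The system is ergodic if every invariant set $A$ satisfies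 $\lambda(A)=0$ or $\lambda(A^c)=0$. (Convention $0\cdot\infty=0$.) *)

theory Defs
  imports "HOL-Analysis.Analysis"
begin

text \<open>All notions below are only meant for sets in \<^term>\<open>sets M\<close>: \<^term>\<open>emeasure M\<close> is
  \<open>0\<close> on non-measurable sets. Preimages and complements are taken within \<^term>\<open>space M\<close>.\<close>

definition ae_subset :: "'a measure \<Rightarrow> 'a set \<Rightarrow> 'a set \<Rightarrow> bool" where
  "ae_subset M A B \<longleftrightarrow> emeasure M (A - B) = 0"

definition ae_eq :: "'a measure \<Rightarrow> 'a set \<Rightarrow> 'a set \<Rightarrow> bool" where
  "ae_eq M A B \<longleftrightarrow> emeasure M ((A - B) \<union> (B - A)) = 0"

definition null_preserving :: "'a measure \<Rightarrow> ('a \<Rightarrow> 'a) \<Rightarrow> bool" where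
  "null_preserving M T \<longleftrightarrow> T \<in> measurable M M \<and>
     (\<forall>A\<in>sets M. emeasure M A = 0 \<longrightarrow> emeasure M (T -` A \<inter> space M) = 0)"

definition essential_image :: "'a measure \<Rightarrow> ('a \<Rightarrow> 'a) \<Rightarrow> 'a set \<Rightarrow> 'a set \<Rightarrow> bool" where
  "essential_image M T A A' \<longleftrightarrow> A' \<in> sets M \<and>
     ae_subset M A (T -` A' \<inter> space M) \<and>
     (\<forall>B'\<in>sets M. ae_subset M A (T -` B' \<inter> space M) \<longrightarrow> ae_subset M A' B')"

definition forward_invariant :: "'a measure \<Rightarrow> ('a \<Rightarrow> 'a) \<Rightarrow> 'a set \<Rightarrow> bool" where
  "forward_invariant M T A \<longleftrightarrow> A \<in> sets M \<and> ae_subset M A (T -` A \<inter> space M)"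

definition invariant :: "'a measure \<Rightarrow> ('a \<Rightarrow> 'a) \<Rightarrow> 'a set \<Rightarrow> bool" where
  "invariant M T A \<longleftrightarrow> A \<in> sets M \<and> ae_eq M A (T -` A \<inter> space M)"

definition ergodic :: "'a measure \<Rightarrow> ('a \<Rightarrow> 'a) \<Rightarrow> bool" where
  "ergodic M T \<longleftrightarrow>
     (\<forall>A. invariant M T A \<longrightarrow> emeasure M A = 0 \<or> emeasure M (space M - A) = 0)"

text \<open>A choice of essential images: the operation usually written \<open>A \<mapsto> T\<close>-hat\<open> A\<close>, an
  arbitrary fixed essential image for every measurable set.\<close>

definition essential_image_choice :: "'a measure \<Rightarrow> ('a \<Rightarrow> 'a) \<Rightarrow> ('a set \<Rightarrow> 'a set) \<Rightarrow> bool" where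
  "essential_image_choice M T That \<longleftrightarrow> (\<forall>A\<in>sets M. essential_image M T A (That A))"

text \<open>Such a choice always exists in the \<open>\<sigma>\<close>-finite null-preserving setting, and it is
  unique up to null sets.\<close>

lemma essential_image_exists:
  assumes "sigma_finite_measure M" and T: "null_preserving M T" and A: "A \<in> sets M"
  shows "\<exists>A'. essential_image M T A A'"
proof -
  interpret sigma_finite_measure M by fact
  have [measurable]: "T \<in> measurable M M" and A[measurable]: "A \<in> sets M"
    using T A by (auto simp: null_preserving_def)
  define N where "N = distr (density M (indicator A)) M T"
  have setsN: "sets N = sets M" by (simp add: N_def)
  have N: "emeasure N B = emeasure M (A \<inter> (T -` B \<inter> space M))" if [measurable]: "B \<in> sets M" for B
  proof -
    have "emeasure N B = emeasure (density M (indicator A)) (T -` B \<inter> space M)"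
      unfolding N_def by (subst emeasure_distr) auto
    also have "\<dots> = (\<integral>\<^sup>+x. indicator A x * indicator (T -` B \<inter> space M) x \<partial>M)"
      by (subst emeasure_density) auto
    also have "\<dots> = (\<integral>\<^sup>+x. indicator (A \<inter> (T -` B \<inter> space M)) x \<partial>M)"
      by (intro nn_integral_cong) (auto split: split_indicator)
    also have "\<dots> = emeasure M (A \<inter> (T -` B \<inter> space M))" by simp
    finally show ?thesis .
  qed
  have "absolutely_continuous M N"
    unfolding absolutely_continuous_def
  proof
    fix B assume B: "B \<in> null_sets M"
    then have m[measurable]: "B \<in> sets M" by auto
    have "emeasure M (T -` B \<inter> space M) = 0"
      using T B by (auto simp: null_preserving_def)
    then have "emeasure M (A \<inter> (T -` B \<inter> space M)) = 0"
      by (rule emeasure_eq_0[rotated]) auto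
    then show "B \<in> null_sets N" by (simp add: N setsN null_sets_def)
  qed
  then obtain f where f[measurable]: "f \<in> borel_measurable M" and dens: "density M f = N"
    using Radon_Nikodym[of N] setsN by auto
  define A' where "A' = {x \<in> space M. f x \<noteq> 0}"
  have A'[measurable]: "A' \<in> sets M" unfolding A'_def by measurable
  have null: "emeasure N B = 0 \<longleftrightarrow> emeasure M (A' \<inter> B) = 0" if [measurable]: "B \<in> sets M" for B
  proof -
    have "emeasure N B = (\<integral>\<^sup>+x. f x * indicator B x \<partial>M)"
      unfolding dens[symmetric] by (subst emeasure_density) auto
    also have "\<dots> = 0 \<longleftrightarrow> emeasure M {x \<in> space M. f x * indicator B x \<noteq> 0} = 0"
      by (subst nn_integral_0_iff) auto
    also have "{x \<in> space M. f x * indicator B x \<noteq> 0} = A' \<inter> B"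
      by (auto simp: A'_def split: split_indicator_asm)
    finally show ?thesis .
  qed
  have iff: "ae_subset M A (T -` B \<inter> space M) \<longleftrightarrow> ae_subset M A' B" if [measurable]: "B \<in> sets M" for B
  proof -
    have "A - (T -` B \<inter> space M) = A \<inter> (T -` (space M - B) \<inter> space M)"
      using sets.sets_into_space[OF A] measurable_space[of T M M] by auto
    moreover have "A' - B = A' \<inter> (space M - B)"
      using sets.sets_into_space[OF A'] by auto
    ultimately show ?thesis
      using N[of "space M - B"] null[of "space M - B"] by (simp add: ae_subset_def)
  qed
  have "essential_image M T A A'"
    unfolding essential_image_def using iff A' by (auto simp: ae_subset_def)
  then show ?thesis ..
qed

lemma essential_image_choice_exists:
  assumes "sigma_finite_measure M" and "null_preserving M T"
  shows "\<exists>That. essential_image_choice M T That"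
  unfolding essential_image_choice_def
  using essential_image_exists[OF assms] by metis

lemma essential_image_unique:
  assumes "essential_image M T A A'" and "essential_image M T A A''"
  shows "ae_eq M A' A''"
proof -
  have "A' - A'' \<in> null_sets M" "A'' - A' \<in> null_sets M"
    using assms by (auto simp: essential_image_def ae_subset_def null_sets_def)
  then have "(A' - A'') \<union> (A'' - A') \<in> null_sets M" by (rule null_sets.Un)
  then show ?thesis by (auto simp: ae_eq_def)
qed

end

theory Submission
  imports Defs
begin

text \<open>An essential image is the least set, up to null sets, whose preimage contains
  \<open>A\<close> almost everywhere. If \<open>A\<close> is forward invariant, \<open>A\<close>
  itself competes in this minimality, so its essential image lies in \<open>A\<close>. Conversely,
  null preservation lets an a.e. inclusion of the image in \<open>A\<close> be pulled back along
  \<open>T\<close>, and chaining it with the defining inclusion gives forward invariance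
  (\<open>forward_invariant_iff_essential_image\<close>). Invariance is forward invariance of
  \<open>A\<close> and of its complement (\<open>invariant_iff_forward_invariant\<close>), so the
  ergodicity criterion follows by rewriting.\<close>

lemma forward_invariant_iff_essential_image:
  assumes T: "null_preserving M T" and A: "A \<in> sets M" and A': "essential_image M T A A'"
  shows "forward_invariant M T A \<longleftrightarrow> ae_subset M A' A"
proof
  assume "forward_invariant M T A"
  then show "ae_subset M A' A"
    using A' by (auto simp: forward_invariant_def essential_image_def)
next
  assume sub: "ae_subset M A' A"
  have [measurable]: "T \<in> measurable M M" "A \<in> sets M" "A' \<in> sets M"
    using T A A' by (auto simp: null_preserving_def essential_image_def)
  have "emeasure M (T -` (A' - A) \<inter> space M) = 0"
    using T sub by (auto simp: null_preserving_def ae_subset_def)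
  then have "T -` (A' - A) \<inter> space M \<in> null_sets M"
    by (intro null_setsI) auto
  moreover have "A - (T -` A' \<inter> space M) \<in> null_sets M"
    using A' by (intro null_setsI) (auto simp: essential_image_def ae_subset_def)
  ultimately have "(A - (T -` A' \<inter> space M)) \<union> (T -` (A' - A) \<inter> space M) \<in> null_sets M"
    by (rule null_sets.Un[rotated])
  \<comment> \<open>A point of \<open>A\<close> not sent into \<open>A\<close> either is not sent
    into \<open>A'\<close> or is sent into \<open>A' - A\<close>; both cases are null.\<close>
  then have "A - (T -` A \<inter> space M) \<in> null_sets M"
    by (rule null_sets_subset) auto
  then show "forward_invariant M T A"
    using A by (auto simp: forward_invariant_def ae_subset_def)
qed

lemma ae_eq_iff_ae_subset:
  assumes "A \<in> sets M" "B \<in> sets M"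
  shows "ae_eq M A B \<longleftrightarrow> ae_subset M A B \<and> ae_subset M B A"
proof -
  have "A - B \<in> sets M" "B - A \<in> sets M"
    using assms by auto
  then show ?thesis
    unfolding ae_eq_def ae_subset_def
    by (metis Un_upper1 Un_upper2 emeasure_Un_null_set emeasure_eq_0 null_setsI sets.Un)
qed

text \<open>Preimages commute with complements in \<open>space M\<close>, so the points that leave
  the complement of \<open>A\<close> under \<open>T\<close> are exactly those of the preimage of
  \<open>A\<close> outside \<open>A\<close>. Forward invariance of the complement is thus the
  reverse inclusion needed for invariance.\<close>

lemma invariant_iff_forward_invariant:
  assumes T: "T \<in> measurable M M" and A: "A \<in> sets M"
  shows "invariant M T A \<longleftrightarrow> forward_invariant M T A \<and> forward_invariant M T (space M - A)"
proof -
  have "(space M - A) - (T -` (space M - A) \<inter> space M) = (T -` A \<inter> space M) - A"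
    using measurable_space[OF T] by auto
  then have "forward_invariant M T (space M - A) \<longleftrightarrow> ae_subset M (T -` A \<inter> space M) A"
    using A by (simp add: forward_invariant_def ae_subset_def)
  then show ?thesis
    using A ae_eq_iff_ae_subset[OF A measurable_sets[OF T A]]
    by (simp add: invariant_def forward_invariant_def)
qed

theorem theorem4p1:
  fixes M :: "'a measure" and T :: "'a \<Rightarrow> 'a" and That :: "'a set \<Rightarrow> 'a set" and A :: "'a set"
  assumes "sigma_finite_measure M"
    and "null_preserving M T"
    and "essential_image_choice M T That"
    and "A \<in> sets M"
  shows "(forward_invariant M T A \<longleftrightarrow> ae_subset M (That A) A) \<and>
    (invariant M T A \<longleftrightarrow>
      ae_subset M (That A) A \<and> ae_subset M (That (space M - A)) (space M - A)) \<and>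
    (ergodic M T \<longleftrightarrow>
      (\<forall>B\<in>sets M. ae_subset M (That B) B \<and> ae_subset M (That (space M - B)) (space M - B)
        \<longrightarrow> emeasure M B * emeasure M (space M - B) = 0))"
proof -
  have forward: "forward_invariant M T B \<longleftrightarrow> ae_subset M (That B) B" if "B \<in> sets M" for B
    using assms that
    by (intro forward_invariant_iff_essential_image) (auto simp: essential_image_choice_def)
  have inv: "invariant M T B \<longleftrightarrow>
      ae_subset M (That B) B \<and> ae_subset M (That (space M - B)) (space M - B)"
    if "B \<in> sets M" for B
    using assms(2) that
    by (simp add: invariant_iff_forward_invariant forward null_preserving_def)
  \<comment> \<open>In the extended nonnegative reals a product vanishes iff a factor does, even
    when the other factor is infinite.\<close>
  have "ergodic M T \<longleftrightarrow>
      (\<forall>B\<in>sets M. invariant M T B \<longrightarrow> emeasure M B * emeasure M (space M - B) = 0)"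
    by (auto simp: ergodic_def invariant_def)
  then show ?thesis
    using forward inv assms(4) by simp
qed

end
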